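(* Let $\Delta_{SAM}:=\langle\Delta\boldsymbol{w}_j^2(t)\rangle_{SAM}$ and $\Delta_{SGD}:=\langle\Delta\boldsymbol{w}_j^2(t)\rangle_{SGD}$ denote the mean squared displacements of SAM and of SGD, respectively, near the saddle point $\boldsymbol{d}$. Then, as $|\lambda_j|t\ll1$ near ill-conditioned saddle points, $$\Delta_{SGD}-\Delta_{SAM}=\frac{2\eta t^2|\lambda_j|^3}{B}\,\rho+\mathcal{O}\bigl(B^{-1}\eta t^3\lambda_j^4\bigr).$$ As $\frac{2\eta t^2|\lambda_j|^3}{B}\rho$ is always positive, the mean squared displacement of SAM is smaller than that of SGD near $\boldsymbol{d}$, which implies that SAM escapes saddle points more slowly than SGD.
   Context: $\ell$ is a loss function of weights $\boldsymbol{w}\in\mathbb{R}^n$, $\boldsymbol{d}$ is a saddle point of $\ell$, and $\lambda_j$ is the $j$-th eigenvalue of the Hessian $H$ of $\ell$ at $\boldsymbol{d}$. $\eta$ is the learning rate, $B$ the batch size, $\rho$ the radius of sharpness-aware minimization (SAM), and $t$ the time. The stochastic SAM dynamics is $d\boldsymbol{w}=-\nabla\ell(\boldsymbol{w}^p)dt+[\eta C(\boldsymbol{w}^p)]^{1/2}dW_t$ with $\boldsymbol{w}^p=\boldsymbol{w}+\rho\nabla\ell(\boldsymbol{w})$, $dW_t\sim\mathcal{N}(0,I\,dt)$ and $C$ the gradient noise covariance. SGD is the case $\rho=0$. The dynamics is started at $\boldsymbol{d}$. Near $\boldsymbol{d}$, $\ell$ is replaced by its second-order Taylor expansion and $C$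 by $\frac1B[H]^+$, where $[H]^+$ is $H$ with its eigenvalues replaced by their absolute values. The displacement $\Delta\boldsymbol{w}_j(t)=\boldsymbol{w}_j(t)-\boldsymbol{w}_j(0)$ along the $j$-th eigendirection is then Gaussian, so the mean squared displacement is its variance, and the values used are $$\Delta_{SAM}=\frac{\eta|\lambda_j|}{2B\lambda_j(1+\rho\lambda_j)^2}\Bigl[1-\exp\bigl(-2\lambda_j(1+\rho\lambda_j)^2t\bigr)\Bigr],\qquad \Delta_{SGD}=\frac{\eta|\lambda_j|}{2B\lambda_j}\bigl[1-\exp(-2\lambda_jt)\bigr].$$
   Formalization: The formal theorem also assumes that ρ stays bounded and ρ² = O(t) along the limit λ_j → 0, |λ_j|t → 0; without this the stated error term fails, e.g. for η = B = ρ = 1 and t = λ_j → 0. *)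

theory Defs
  imports "HOL-Probability.Probability" "HOL-Library.Landau_Symbols"
begin

text \<open>A critical point that is neither a local minimum nor a local maximum.\<close>

definition saddle_point :: "('a::real_inner \<Rightarrow> real) \<Rightarrow> 'a \<Rightarrow> bool" where
  "saddle_point f d \<longleftrightarrow>
     GDERIV f d :> 0 \<and>
     (\<forall>\<epsilon>>0. \<exists>x\<in>ball d \<epsilon>. f x < f d) \<and>
     (\<forall>\<epsilon>>0. \<exists>x\<in>ball d \<epsilon>. f x > f d)"

text \<open>The Hessian is the Jacobian matrix of the gradient field.\<close>

definition has_hessian :: "(real ^ 'n \<Rightarrow> real) \<Rightarrow> real ^ 'n ^ 'n \<Rightarrow> real ^ 'n \<Rightarrow> bool" where
  "has_hessian f H d \<longleftrightarrow>
     (\<exists>g. (\<forall>\<^sub>F x in nhds d. GDERIV f x :> g x) \<and> (g has_derivative (\<lambda>h. H *v h)) (at d))"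

definition unit_eigenpair :: "real ^ 'n ^ 'n \<Rightarrow> real \<Rightarrow> real ^ 'n \<Rightarrow> bool" where
  "unit_eigenpair H lam v \<longleftrightarrow> norm v = 1 \<and> H *v v = lam *\<^sub>R v"

definition displacement :: "(real \<Rightarrow> 'o \<Rightarrow> 'a::real_inner) \<Rightarrow> 'a \<Rightarrow> real \<Rightarrow> 'o \<Rightarrow> real" where
  "displacement w v t \<omega> = (w t \<omega> - w 0 \<omega>) \<bullet> v"

definition mean_squared_displacement ::
    "'o measure \<Rightarrow> (real \<Rightarrow> 'o \<Rightarrow> 'a::real_inner) \<Rightarrow> 'a \<Rightarrow> real \<Rightarrow> real" where
  "mean_squared_displacement M w v t = (\<integral>\<omega>. (displacement w v t \<omega>)\<^sup>2 \<partial>M)"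

text \<open>Displacement variances at time \<open>t\<close> along an eigendirection with eigenvalue \<open>lam \<noteq> 0\<close>, for
  the quadratic model of the loss with gradient noise covariance \<open>\<bar>H\<bar> / B\<close>.\<close>

definition sam_variance :: "real \<Rightarrow> nat \<Rightarrow> real \<Rightarrow> real \<Rightarrow> real \<Rightarrow> real" where
  "sam_variance \<eta> B \<rho> lam t =
     \<eta> * \<bar>lam\<bar> / (2 * real B * lam * (1 + \<rho> * lam)\<^sup>2) *
       (1 - exp (- 2 * lam * (1 + \<rho> * lam)\<^sup>2 * t))"

definition sgd_variance :: "real \<Rightarrow> nat \<Rightarrow> real \<Rightarrow> real \<Rightarrow> real" where
  "sgd_variance \<eta> B lam t =
     \<eta> * \<bar>lam\<bar> / (2 * real B * lam) * (1 - exp (- 2 * lam * t))"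

lemma sam_variance_zero_radius: "sam_variance \<eta> B 0 lam t = sgd_variance \<eta> B lam t"
  by (simp add: sam_variance_def sgd_variance_def)

text \<open>A weight process started at \<open>d\<close> whose displacement along \<open>v\<close> is a centred Gaussian of
  variance \<open>V t\<close> at every time \<open>t > 0\<close>; \<open>normal_density\<close> takes the standard deviation.\<close>

definition gaussian_displacement_from ::
    "'a::real_inner \<Rightarrow> 'a \<Rightarrow> (real \<Rightarrow> real) \<Rightarrow> 'o measure \<Rightarrow> (real \<Rightarrow> 'o \<Rightarrow> 'a) \<Rightarrow> bool" where
  "gaussian_displacement_from d v V M w \<longleftrightarrow>
     prob_space M \<and>
     (AE \<omega> in M. w 0 \<omega> = d) \<and>
     (\<forall>t>0. distributed M lborel (displacement w v t) (normal_density 0 (sqrt (V t))))"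

end

theory Submission
  imports Defs
begin

text \<open>
  Both variances are values of the one function \<open>\<phi> x = (1 - exp (- x)) / x\<close>: with
  \<open>s = (1 + \<rho> \<lambda>)\<^sup>2\<close> they are \<open>\<eta> \<bar>\<lambda>\<bar> t / B\<close> times \<open>\<phi> (2 \<lambda> s t)\<close> and \<open>\<phi> (2 \<lambda> t)\<close>. As \<open>\<phi>\<close> is
  decreasing and \<open>\<lambda> s > \<lambda>\<close> for either sign of \<open>\<lambda>\<close>, SAM has the smaller variance. Near \<open>0\<close> the
  derivative of \<open>\<phi>\<close> is \<open>-1/2 + O(x)\<close>, so the mean value theorem bounds the error of the
  linear approximation of \<open>\<phi> (2 \<lambda> t) - \<phi> (2 \<lambda> s t)\<close> by a multiple of \<open>\<lambda>\<^sup>2 t\<^sup>2 \<bar>s - 1\<bar>\<close>. The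
  factor \<open>s - 1 = O(\<lambda>)\<close> supplies the fourth power of \<open>\<lambda>\<close>. The quadratic part \<open>\<rho>\<^sup>2 \<lambda>\<^sup>2\<close> of
  \<open>s - 1\<close> in the linear term is an error of the right order because \<open>\<rho>\<^sup>2 = O(t)\<close>.
\<close>

section \<open>Calculus of the quotient \<open>(1 - exp (- x)) / x\<close>\<close>

definition exp_quotient :: "real \<Rightarrow> real" where
  "exp_quotient x = (1 - exp (- x)) / x"

lemma sgd_variance_eq_exp_quotient:
  assumes "lam \<noteq> 0" "t \<noteq> 0"
  shows "sgd_variance \<eta> B lam t = \<eta> * \<bar>lam\<bar> * t / real B * exp_quotient (2 * lam * t)"
  using assms by (cases "B = 0") (simp_all add: sgd_variance_def exp_quotient_def)

lemma sam_variance_eq_exp_quotient: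
  assumes "lam \<noteq> 0" "t \<noteq> 0" "1 + \<rho> * lam \<noteq> 0"
  shows "sam_variance \<eta> B \<rho> lam t =
    \<eta> * \<bar>lam\<bar> * t / real B * exp_quotient (2 * lam * t * (1 + \<rho> * lam)\<^sup>2)"
  using assms by (cases "B = 0") (simp_all add: sam_variance_def exp_quotient_def ac_simps)

lemma exp_quotient_has_real_derivative:
  assumes "x \<noteq> 0"
  shows "(exp_quotient has_real_derivative ((x + 1) * exp (- x) - 1) / x\<^sup>2) (at x)"
  unfolding exp_quotient_def [abs_def] using assms
  by (auto intro!: derivative_eq_intros simp: power2_eq_square algebra_simps)

text \<open>The sign condition keeps 0 out of the interval: there division by zero yields 0 instead
  of the limit 1, so \<open>exp_quotient\<close> is discontinuous.\<close>

lemma exp_quotient_strict_antimono: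
  assumes "x < y" and "0 < x \<or> y < 0"
  shows "exp_quotient y < exp_quotient x"
proof (rule DERIV_neg_imp_decreasing [OF \<open>x < y\<close>])
  fix z assume "x \<le> z" "z \<le> y"
  with assms have "z \<noteq> 0" by auto
  \<comment> \<open>Strictness: \<open>ln u = u - 1\<close> forces \<open>u = 1\<close>, applied to
    \<open>u = exp z\<close>. Multiplied by \<open>exp (- z)\<close>, the strict inequality makes
    the numerator of the derivative negative.\<close>
  have "z + 1 \<noteq> exp z"
    using ln_eq_minus_one [of "exp z"] \<open>z \<noteq> 0\<close> by auto
  then have "z + 1 < exp z"
    using exp_ge_add_one_self [of z] by linarith
  then have "(z + 1) * exp (- z) < 1"
    by (simp add: exp_minus field_simps)
  with \<open>z \<noteq> 0\<close> have "((z + 1) * exp (- z) - 1) / z\<^sup>2 < 0"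
    by (simp add: divide_less_0_iff)
  with exp_quotient_has_real_derivative [OF \<open>z \<noteq> 0\<close>]
  show "\<exists>D. (exp_quotient has_real_derivative D) (at z) \<and> D < 0" by blast
qed

lemma abs_one_minus_exp_le:
  fixes x :: real
  assumes "\<bar>x\<bar> \<le> 1"
  shows "\<bar>1 - exp (- x)\<bar> \<le> 2 * \<bar>x\<bar>"
proof (cases "0 \<le> x")
  case True
  then show ?thesis using exp_ge_add_one_self [of "- x"] exp_le_one_iff [of "- x"] by simp
next
  case False
  \<comment> \<open>\<open>exp_bound\<close> wants an argument in \<open>[0, 1]\<close>, hence
    \<open>- x\<close>. The square is absorbed into the linear term, which doubles the
    constant.\<close>
  have "exp (- x) \<le> 1 + (- x) + (- x)\<^sup>2"
    using False assms by (intro exp_bound) auto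
  moreover have "(- x)\<^sup>2 \<le> - x"
    using False assms mult_left_le [of "- x" "- x"] by (simp add: power2_eq_square)
  moreover have "1 \<le> exp (- x)" using False by simp
  ultimately show ?thesis using False by linarith
qed

text \<open>Multiplying by \<open>x\<^sup>2\<close> removes the singularity: \<open>?k\<close>
  vanishes at 0 and its derivative \<open>z * (1 - exp (- z))\<close> is quadratically small, so
  \<open>?k x\<close> is cubically small and one factor of \<open>\<bar>x\<bar>\<close> survives the
  division.\<close>

lemma abs_exp_quotient_deriv_plus_half_le:
  fixes x :: real
  assumes "x \<noteq> 0" "\<bar>x\<bar> \<le> 1"
  shows "\<bar>((x + 1) * exp (- x) - 1) / x\<^sup>2 + 1 / 2\<bar> \<le> 2 * \<bar>x\<bar>"
proof -
  let ?k = "\<lambda>x::real. (x + 1) * exp (- x) - 1 + x\<^sup>2 / 2"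
  have "norm (?k x - ?k 0) \<le> 2 * x\<^sup>2 * norm (x - 0)"
  proof (rule field_differentiable_bound [where S = "closed_segment 0 x"
        and f' = "\<lambda>z. z * (1 - exp (- z))"])
    fix z assume z: "z \<in> closed_segment 0 x"
    show "(?k has_field_derivative z * (1 - exp (- z))) (at z within closed_segment 0 x)"
      by (auto intro!: derivative_eq_intros simp: algebra_simps)
    have "\<bar>z\<bar> \<le> \<bar>x\<bar>"
      using z by (auto simp: closed_segment_eq_real_ivl split: if_splits)
    then have "\<bar>z\<bar> * \<bar>1 - exp (- z)\<bar> \<le> \<bar>x\<bar> * (2 * \<bar>x\<bar>)"
      using abs_one_minus_exp_le [of z] assms by (intro mult_mono) auto
    then show "norm (z * (1 - exp (- z))) \<le> 2 * x\<^sup>2"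
      by (simp add: abs_mult power2_eq_square)
  qed auto
  then have k: "\<bar>?k x\<bar> \<le> 2 * \<bar>x\<bar> * x\<^sup>2" by (simp add: ac_simps)
  have "((x + 1) * exp (- x) - 1) / x\<^sup>2 + 1 / 2 = ?k x / x\<^sup>2"
    using assms by (simp add: field_simps)
  then show ?thesis
    using k assms by (simp add: abs_divide divide_le_eq)
qed

text \<open>Adding \<open>z / 2\<close> cancels the constant term of the derivative. On the segment
  the remaining derivative is at most \<open>2 * \<bar>z\<bar> \<le> 4 * \<bar>a\<bar>\<close>, and
  the segment has length \<open>\<bar>a\<bar> * \<bar>s - 1\<bar>\<close>.\<close>

lemma exp_quotient_diff_approx:
  assumes "a \<noteq> 0" "\<bar>a\<bar> \<le> 1 / 2" "0 < s" "s \<le> 2"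
  shows "\<bar>exp_quotient a - exp_quotient (a * s) - a * (s - 1) / 2\<bar> \<le> 4 * a\<^sup>2 * \<bar>s - 1\<bar>"
proof -
  let ?S = "closed_segment a (a * s)"
  let ?\<psi> = "\<lambda>z. exp_quotient z + z / 2"
  have "norm (?\<psi> a - ?\<psi> (a * s)) \<le> (4 * \<bar>a\<bar>) * norm (a - a * s)"
  proof (rule field_differentiable_bound [where S = ?S
        and f' = "\<lambda>z. ((z + 1) * exp (- z) - 1) / z\<^sup>2 + 1 / 2"])
    fix z assume "z \<in> ?S"
    then obtain u where u: "0 \<le> u" "u \<le> 1" and z: "z = (1 - u) * a + u * (a * s)"
      by (auto simp: in_segment)
    \<comment> \<open>\<open>r\<close> lies between 1 and \<open>s\<close>, so
      \<open>0 < r \<le> 2\<close>: \<open>z\<close> has the sign of \<open>a\<close>, and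
      \<open>\<bar>z\<bar> \<le> 2 * \<bar>a\<bar> \<le> 1\<close>.\<close>
    define r where "r = (1 - u) + u * s"
    have za: "z = a * r" by (simp add: z r_def algebra_simps)
    have "0 < r"
      using u \<open>0 < s\<close> by (cases "u = 0") (auto simp: r_def intro: add_nonneg_pos)
    have "u * s \<le> u * 2" using u assms by (intro mult_left_mono) auto
    then have "r \<le> 2" using u by (simp add: r_def)
    have "z \<noteq> 0" using za assms \<open>0 < r\<close> by simp
    have "\<bar>a\<bar> * r \<le> \<bar>a\<bar> * 2" using \<open>r \<le> 2\<close> by (intro mult_left_mono) auto
    then have z2: "\<bar>z\<bar> \<le> 2 * \<bar>a\<bar>" using \<open>0 < r\<close> by (simp add: za abs_mult)
    show "(?\<psi> has_field_derivative ((z + 1) * exp (- z) - 1) / z\<^sup>2 + 1 / 2) (at z within ?S)"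
      using exp_quotient_has_real_derivative [OF \<open>z \<noteq> 0\<close>]
      by (auto intro!: derivative_eq_intros intro: DERIV_subset)
    show "norm (((z + 1) * exp (- z) - 1) / z\<^sup>2 + 1 / 2) \<le> 4 * \<bar>a\<bar>"
      using abs_exp_quotient_deriv_plus_half_le [OF \<open>z \<noteq> 0\<close>] z2 assms by simp
  qed auto
  moreover have "?\<psi> a - ?\<psi> (a * s) = exp_quotient a - exp_quotient (a * s) - a * (s - 1) / 2"
    by (simp add: field_simps)
  moreover have "norm (a - a * s) = \<bar>a\<bar> * \<bar>s - 1\<bar>"
    by (metis abs_minus_commute abs_mult mult.right_neutral real_norm_def right_diff_distrib)
  ultimately show ?thesis by (simp add: power2_eq_square flip: mult.assoc)
qed

section \<open>Second moment of a centred Gaussian displacement\<close>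

lemma mean_squared_displacement_gaussian:
  assumes "gaussian_displacement_from d v V M w" "t > 0" "0 \<le> V t"
  shows "mean_squared_displacement M w v t = V t"
proof -
  interpret prob_space M
    using assms by (simp add: gaussian_displacement_from_def)
  have D: "distributed M lborel (displacement w v t) (normal_density 0 (sqrt (V t)))"
    using assms by (simp add: gaussian_displacement_from_def)
  \<comment> \<open>For \<open>V t = 0\<close> the term \<open>normal_density\<close> is \<open>1 / 0 = 0\<close>, which is not a density.\<close>
  have pos: "0 < V t"
  proof (rule ccontr)
    assume "\<not> 0 < V t"
    then have "normal_density 0 (sqrt (V t)) x = 0" for x
      using assms by (simp add: normal_density_def)
    then have "emeasure M (displacement w v t -` UNIV \<inter> space M) = 0"
      using distributed_emeasure [OF D, of UNIV] by simp
    then show False by (simp add: emeasure_space_1)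
  qed
  then have "expectation (displacement w v t) = 0" "variance (displacement w v t) = V t"
    using normal_distributed_expectation [OF _ D] normal_distributed_variance [OF _ D] by simp_all
  then show ?thesis by (simp add: mean_squared_displacement_def)
qed

section \<open>Comparison of the two variances\<close>

lemma sam_variance_nonneg:
  assumes "0 \<le> \<eta>" "0 \<le> t"
  shows "0 \<le> sam_variance \<eta> B \<rho> lam t"
proof (cases "0 \<le> lam")
  case True
  then show ?thesis using assms by (simp add: sam_variance_def)
next
  case False
  then have "2 * real B * lam * (1 + \<rho> * lam)\<^sup>2 \<le> 0"
    by (intro mult_nonpos_nonneg mult_nonneg_nonpos) auto
  then have "\<eta> * \<bar>lam\<bar> / (2 * real B * lam * (1 + \<rho> * lam)\<^sup>2) \<le> 0"
    using assms by (intro divide_nonneg_nonpos) auto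
  moreover have "lam * (1 + \<rho> * lam)\<^sup>2 * t \<le> 0"
    using False assms by (intro mult_nonpos_nonneg) auto
  then have "1 - exp (- 2 * lam * (1 + \<rho> * lam)\<^sup>2 * t) \<le> 0"
    by (simp add: ac_simps)
  ultimately show ?thesis
    unfolding sam_variance_def by (rule mult_nonpos_nonpos)
qed

lemma sam_variance_less_sgd_variance:
  assumes "lam \<noteq> 0" "t > 0" "\<eta> > 0" "B > 0" "\<rho> > 0" "\<bar>\<rho> * lam\<bar> < 1"
  shows "sam_variance \<eta> B \<rho> lam t < sgd_variance \<eta> B lam t"
proof -
  define s where "s = (1 + \<rho> * lam)\<^sup>2"
  have nz: "1 + \<rho> * lam \<noteq> 0" and "0 < s" using assms by (auto simp: s_def)
  have "exp_quotient (2 * lam * t * s) < exp_quotient (2 * lam * t)"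
  proof (rule exp_quotient_strict_antimono)
    \<comment> \<open>Only the square of \<open>lam\<close> and the factor
      \<open>2 + \<rho> * lam\<close>, positive as \<open>\<bar>\<rho> * lam\<bar> < 1\<close>,
      remain, so the sign of \<open>lam\<close> does not matter.\<close>
    have "lam * (s - 1) = \<rho> * lam\<^sup>2 * (2 + \<rho> * lam)"
      by (simp add: s_def power2_eq_square algebra_simps)
    also have "\<dots> > 0" using assms by (intro mult_pos_pos) auto
    finally have "0 < 2 * t * (lam * (s - 1))" using assms by simp
    then show "2 * lam * t < 2 * lam * t * s" by (simp add: algebra_simps)
    show "0 < 2 * lam * t \<or> 2 * lam * t * s < 0"
      using assms \<open>0 < s\<close> by (auto simp: zero_less_mult_iff mult_less_0_iff)
  qed
  then show ?thesis
    using assms nz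
    by (simp add: sgd_variance_eq_exp_quotient sam_variance_eq_exp_quotient s_def
        mult_strict_left_mono divide_strict_right_mono)
qed

text \<open>The term \<open>\<rho>\<^sup>2 / t\<close> comes from the quadratic part of
  \<open>s - 1\<close>. The 48 is \<open>4 * 4 * 3\<close>: the constant of
  \<open>exp_quotient_diff_approx\<close>, the 4 in
  \<open>a\<^sup>2 = 4 * lam\<^sup>2 * t\<^sup>2\<close>, and
  \<open>\<bar>2 + \<rho> * lam\<bar> \<le> 3\<close>. The bounds by \<open>1 / 4\<close> ensure
  \<open>s \<le> 2\<close> and \<open>\<bar>a\<bar> \<le> 1 / 2\<close>.\<close>

lemma sgd_minus_sam_variance_approx:
  assumes "lam \<noteq> 0" "t > 0" "\<eta> > 0" "B > 0" "\<rho> > 0" "\<bar>\<rho> * lam\<bar> \<le> 1 / 4" "\<bar>lam\<bar> * t \<le> 1 / 4"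
  shows "\<bar>sgd_variance \<eta> B lam t - sam_variance \<eta> B \<rho> lam t
            - 2 * \<eta> * t\<^sup>2 * \<bar>lam\<bar> ^ 3 / real B * \<rho>\<bar>
         \<le> (\<rho>\<^sup>2 / t + 48 * \<rho>) * (\<eta> * t ^ 3 * lam ^ 4 / real B)"
proof -
  define s where "s = (1 + \<rho> * lam)\<^sup>2"
  define a where "a = 2 * lam * t"
  define c where "c = \<eta> * \<bar>lam\<bar> * t / real B"
  define e where "e = exp_quotient a - exp_quotient (a * s) - a * (s - 1) / 2"
  have nz: "1 + \<rho> * lam \<noteq> 0" and "0 < s" using assms by (auto simp: s_def)
  have "0 \<le> c" using assms by (simp add: c_def)
  have s1: "s - 1 = \<rho> * lam * (2 + \<rho> * lam)"
    by (simp add: s_def power2_eq_square algebra_simps)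
  have "(1 + \<rho> * lam)\<^sup>2 \<le> (5 / 4)\<^sup>2"
    using assms by (intro power_mono) auto
  then have "s \<le> 2" by (simp add: s_def power2_eq_square)
  have "\<bar>a\<bar> \<le> 1 / 2" "a \<noteq> 0"
    using assms by (simp_all add: a_def abs_mult)
  then have "\<bar>e\<bar> \<le> 4 * a\<^sup>2 * \<bar>s - 1\<bar>"
    unfolding e_def using \<open>0 < s\<close> \<open>s \<le> 2\<close> by (intro exp_quotient_diff_approx)
  also have "\<bar>s - 1\<bar> \<le> \<rho> * \<bar>lam\<bar> * 3"
    unfolding s1 abs_mult using assms by (intro mult_mono) auto
  also have "4 * a\<^sup>2 * (\<rho> * \<bar>lam\<bar> * 3) = 48 * \<rho> * t\<^sup>2 * \<bar>lam\<bar> ^ 3"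
    by (simp add: a_def power_mult_distrib power2_eq_square power3_eq_cube)
  finally have e: "\<bar>e\<bar> \<le> 48 * \<rho> * t\<^sup>2 * \<bar>lam\<bar> ^ 3" by (simp add: mult_left_mono)
  have "2 * \<eta> * t\<^sup>2 * \<bar>lam\<bar> ^ 3 / real B * \<rho> = c * (2 * t * lam\<^sup>2 * \<rho>)"
    by (simp add: c_def power2_eq_square power3_eq_cube)
  moreover have "a * (s - 1) / 2 = 2 * t * lam\<^sup>2 * \<rho> + t * lam ^ 3 * \<rho>\<^sup>2"
    by (simp add: a_def s1 power2_eq_square power3_eq_cube algebra_simps)
  moreover have "sgd_variance \<eta> B lam t = c * exp_quotient a"
    "sam_variance \<eta> B \<rho> lam t = c * exp_quotient (a * s)"
    using assms nz
    by (simp_all add: sgd_variance_eq_exp_quotient sam_variance_eq_exp_quotient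
        a_def c_def s_def)
  ultimately have "sgd_variance \<eta> B lam t - sam_variance \<eta> B \<rho> lam t
      - 2 * \<eta> * t\<^sup>2 * \<bar>lam\<bar> ^ 3 / real B * \<rho> = c * (t * lam ^ 3 * \<rho>\<^sup>2 + e)"
    unfolding e_def by (simp only: right_diff_distrib distrib_left)
  then have "\<bar>sgd_variance \<eta> B lam t - sam_variance \<eta> B \<rho> lam t
      - 2 * \<eta> * t\<^sup>2 * \<bar>lam\<bar> ^ 3 / real B * \<rho>\<bar> = c * \<bar>t * lam ^ 3 * \<rho>\<^sup>2 + e\<bar>"
    using \<open>0 \<le> c\<close> by (simp add: abs_mult)
  also have "\<dots> \<le> c * (t * \<bar>lam\<bar> ^ 3 * \<rho>\<^sup>2 + 48 * \<rho> * t\<^sup>2 * \<bar>lam\<bar> ^ 3)"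
  proof (rule mult_left_mono [OF _ \<open>0 \<le> c\<close>])
    have "\<bar>t * lam ^ 3 * \<rho>\<^sup>2\<bar> = t * \<bar>lam\<bar> ^ 3 * \<rho>\<^sup>2"
      using assms by (simp add: abs_mult power_abs)
    with e show "\<bar>t * lam ^ 3 * \<rho>\<^sup>2 + e\<bar> \<le> t * \<bar>lam\<bar> ^ 3 * \<rho>\<^sup>2 + 48 * \<rho> * t\<^sup>2 * \<bar>lam\<bar> ^ 3"
      by linarith
  qed
  also have "\<dots> = (\<rho>\<^sup>2 / t + 48 * \<rho>) * (\<eta> * t ^ 3 * \<bar>lam\<bar> ^ 4 / real B)"
    using assms by (simp add: c_def field_simps power2_eq_square power3_eq_cube power4_eq_xxxx)
  finally show ?thesis by simp
qed

text \<open>The regime is a filter on an index type along which the loss, the saddle point and all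
  parameters may vary, so one constant serves for the whole family eventually.\<close>

theorem corollary1:
  fixes F :: "'i filter"
    and loss :: "'i \<Rightarrow> real ^ 'n \<Rightarrow> real"
    and d v :: "'i \<Rightarrow> real ^ 'n"
    and H :: "'i \<Rightarrow> real ^ 'n ^ 'n"
    and lam \<eta> \<rho> t :: "'i \<Rightarrow> real"
    and B :: "'i \<Rightarrow> nat"
    and M_SAM :: "'i \<Rightarrow> 'o measure"
    and M_SGD :: "'i \<Rightarrow> 'p measure"
    and w_SAM :: "'i \<Rightarrow> real \<Rightarrow> 'o \<Rightarrow> real ^ 'n"
    and w_SGD :: "'i \<Rightarrow> real \<Rightarrow> 'p \<Rightarrow> real ^ 'n"
  defines "\<Delta>_SAM \<equiv> \<lambda>i. mean_squared_displacement (M_SAM i) (w_SAM i) (v i) (t i)"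
    and "\<Delta>_SGD \<equiv> \<lambda>i. mean_squared_displacement (M_SGD i) (w_SGD i) (v i) (t i)"
  assumes saddle: "\<And>i. saddle_point (loss i) (d i)"
    and hessian: "\<And>i. has_hessian (loss i) (H i) (d i)"
    and eigen: "\<And>i. unit_eigenpair (H i) (lam i) (v i)"
    and lam_nonzero: "\<And>i. lam i \<noteq> 0"
    and eta_pos: "\<And>i. \<eta> i > 0"
    and B_pos: "\<And>i. B i > 0"
    and rho_pos: "\<And>i. \<rho> i > 0"
    and t_pos: "\<And>i. t i > 0"
    and SAM: "\<And>i. gaussian_displacement_from (d i) (v i)
                (sam_variance (\<eta> i) (B i) (\<rho> i) (lam i)) (M_SAM i) (w_SAM i)"
    and SGD: "\<And>i. gaussian_displacement_from (d i) (v i)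
                (sgd_variance (\<eta> i) (B i) (lam i)) (M_SGD i) (w_SGD i)"
    and ill_conditioned: "(lam \<longlongrightarrow> 0) F"
    and short_time: "((\<lambda>i. \<bar>lam i\<bar> * t i) \<longlongrightarrow> 0) F"
    and rho_bounded: "\<rho> \<in> O[F](\<lambda>_. 1)"
    and rho_time: "(\<lambda>i. (\<rho> i)\<^sup>2) \<in> O[F](t)"
  shows "(\<lambda>i. \<Delta>_SGD i - \<Delta>_SAM i - 2 * \<eta> i * (t i)\<^sup>2 * \<bar>lam i\<bar> ^ 3 / real (B i) * \<rho> i)
           \<in> O[F](\<lambda>i. \<eta> i * (t i) ^ 3 * (lam i) ^ 4 / real (B i)) \<and>
         (\<forall>i. 2 * \<eta> i * (t i)\<^sup>2 * \<bar>lam i\<bar> ^ 3 / real (B i) * \<rho> i > 0) \<and>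
         (\<forall>\<^sub>F i in F. \<Delta>_SAM i < \<Delta>_SGD i)"
proof -
  have msd_SAM: "\<Delta>_SAM i = sam_variance (\<eta> i) (B i) (\<rho> i) (lam i) (t i)" for i
    unfolding \<Delta>_SAM_def using eta_pos [of i] t_pos [of i]
    by (intro mean_squared_displacement_gaussian [OF SAM] sam_variance_nonneg) auto
  have msd_SGD: "\<Delta>_SGD i = sgd_variance (\<eta> i) (B i) (lam i) (t i)" for i
    unfolding \<Delta>_SGD_def using eta_pos [of i] t_pos [of i]
      sam_variance_nonneg [of "\<eta> i" "t i" "B i" 0 "lam i"]
    by (intro mean_squared_displacement_gaussian [OF SGD]) (auto simp: sam_variance_zero_radius)
  \<comment> \<open>The bound \<open>1 * 1\<close> is the shape that the product rule for a big-O
    and a small-o factor produces.\<close>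
  have "(\<lambda>i. \<rho> i * lam i) \<in> o[F](\<lambda>_. 1 * 1)"
    using rho_bounded smalloI_tendsto [of lam "\<lambda>_. 1" F] ill_conditioned
    by (intro landau_o.big_small_mult) auto
  then have "((\<lambda>i. \<bar>\<rho> i * lam i\<bar>) \<longlongrightarrow> 0) F"
    by (intro tendsto_rabs_zero) (auto dest: smalloD_tendsto)
  then have small: "\<forall>\<^sub>F i in F. \<bar>\<rho> i * lam i\<bar> < 1 / 4"
    by (rule order_tendstoD) simp
  have short: "\<forall>\<^sub>F i in F. \<bar>lam i\<bar> * t i < 1 / 4"
    using short_time by (rule order_tendstoD) simp
  obtain K where K: "\<forall>\<^sub>F i in F. norm (\<rho> i) \<le> K * norm (1::real)"
    using rho_bounded by (rule landau_o.bigE)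
  obtain L where L: "\<forall>\<^sub>F i in F. norm ((\<rho> i)\<^sup>2) \<le> L * norm (t i)"
    using rho_time by (rule landau_o.bigE)
  have "\<forall>\<^sub>F i in F. norm (\<Delta>_SGD i - \<Delta>_SAM i - 2 * \<eta> i * (t i)\<^sup>2 * \<bar>lam i\<bar> ^ 3 / real (B i) * \<rho> i)
      \<le> (L + 48 * K) * norm (\<eta> i * (t i) ^ 3 * (lam i) ^ 4 / real (B i))"
    using small short K L
  proof eventually_elim
    case (elim i)
    let ?m = "\<eta> i * (t i) ^ 3 * (lam i) ^ 4 / real (B i)"
    have m: "0 \<le> ?m" using eta_pos [of i] t_pos [of i] by simp
    have "(\<rho> i)\<^sup>2 / t i \<le> L" "\<rho> i \<le> K"
      using elim t_pos [of i] by (simp_all add: divide_le_eq)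
    then have "((\<rho> i)\<^sup>2 / t i + 48 * \<rho> i) * ?m \<le> (L + 48 * K) * ?m"
      using m by (intro mult_right_mono) auto
    moreover have "\<bar>\<Delta>_SGD i - \<Delta>_SAM i - 2 * \<eta> i * (t i)\<^sup>2 * \<bar>lam i\<bar> ^ 3 / real (B i) * \<rho> i\<bar>
        \<le> ((\<rho> i)\<^sup>2 / t i + 48 * \<rho> i) * ?m"
      unfolding msd_SAM msd_SGD
      using elim lam_nonzero t_pos eta_pos B_pos rho_pos
      by (intro sgd_minus_sam_variance_approx) auto
    ultimately show ?case
      unfolding real_norm_def abs_of_nonneg [OF m] by linarith
  qed
  then have "(\<lambda>i. \<Delta>_SGD i - \<Delta>_SAM i - 2 * \<eta> i * (t i)\<^sup>2 * \<bar>lam i\<bar> ^ 3 / real (B i) * \<rho> i)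
      \<in> O[F](\<lambda>i. \<eta> i * (t i) ^ 3 * (lam i) ^ 4 / real (B i))"
    by (rule bigoI)
  moreover have "\<forall>i. 2 * \<eta> i * (t i)\<^sup>2 * \<bar>lam i\<bar> ^ 3 / real (B i) * \<rho> i > 0"
    using lam_nonzero t_pos eta_pos B_pos rho_pos by (simp add: less_imp_neq [symmetric])
  \<comment> \<open>The expansion alone does not give this: its error need not be dominated by the
    leading term when \<open>\<rho> i\<close> is small against
    \<open>\<bar>lam i\<bar> * t i\<close>. Monotonicity of \<open>exp_quotient\<close>
    does.\<close>
  moreover have "\<forall>\<^sub>F i in F. \<Delta>_SAM i < \<Delta>_SGD i"
    using small
  proof eventually_elim
    case (elim i)
    then show ?case
      unfolding msd_SAM msd_SGD using lam_nonzero t_pos eta_pos B_pos rho_pos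
      by (intro sam_variance_less_sgd_variance) auto
  qed
  ultimately show ?thesis by blast
qed

end
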